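(* Let $N\ge 2$ be an integer and $\alpha\in(0,1)$. There exist constants $C_1,C_2>0$, depending only on $\alpha$ and $N$, such that for every $u=(v,a_2,\dots,a_{N+1})\in\mathcal{H}_\alpha(\mathbb{T})$, with $\bar v:=\int_0^1 v(x)\,dx$, $$C_1\Big([v]_{H^\alpha(0,1)}^2+\lVert v-\bar v\rVert_{L^2(0,1)}^2+\sum_{k=2}^{N+1}\lvert a_k-\bar v\rvert^2\Big)\le \mathcal{E}_\alpha(u)\le C_2\Big([v]_{H^\alpha(0,1)}^2+\lVert v-\bar v\rVert_{L^2(0,1)}^2+\sum_{k=2}^{N+1}\lvert a_k-\bar v\rvert^2\Big).$$
   Context: Let $D=\{2,3,\dots,N+1\}$ and $\mathbb{T}=[0,1]\cup D\subset\mathbb{R}$, with the positive finite Borel measure $\mu(A)=\int_{A\cap[0,1]}dx+\sum_{k=2}^{N+1}\delta_k(A)$, so that $\int_{\mathbb{T}} f\,d\mu=\int_0^1 f(x)\,dx+\sum_{k=2}^{N+1}f(k)$. A function $u:\mathbb{T}\to\mathbb{R}$ is written $u=(v,a_2,\dots,a_{N+1})$ with $v=u|_{[0,1]}$ and $a_k=u(k)$. The Gagliardo seminorm is $[v]_{H^\alpha(0,1)}^2=\int_0^1\int_0^1\frac{|v(x)-v(y)|^2}{|x-y|^{1+2\alpha}}\,dx\,dy$, and $H^\alpha(0,1)=\{v\in L^2(0,1):[v]_{H^\alpha(0,1)}<\infty\}$. The hybrid energy space is $\mathcal{H}_\alpha(\mathbb{T})=\{u=(v,a_2,\dots,a_{N+1}):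 v\in H^\alpha(0,1),\ a_k\in\mathbb{R}\}$. The energy is $\mathcal{E}_\alpha(u)=\iint_{\mathbb{T}\times\mathbb{T}}\frac{|u(x)-u(y)|^2}{|x-y|^{1+2\alpha}}\,d\mu(x)\,d\mu(y)$, where the integrand is taken to be $0$ on the diagonal $x=y$. *)

theory Defs
  imports "HOL-Analysis.Analysis"
begin

text \<open>
  Functions on the unit interval and on the hybrid set are total functions on the reals of which
  only the values on \<open>{0..1}\<close>, respectively on \<open>hybrid_set N\<close>, matter.  Elements of Lebesgue and
  Sobolev spaces are rendered as Borel measurable representatives (each class has one, and all
  quantities below are invariant under changes on null subsets of the unit interval).
  Integrals of nonnegative functions take values in \<^typ>\<open>ennreal\<close>, so that no
  finiteness is built in.  The closed interval is used for integrals over the open one.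
\<close>

definition hybrid_set :: "nat \<Rightarrow> real set" where
  "hybrid_set N = {0..1} \<union> real ` {2..N+1}"

definition hybrid_measure :: "nat \<Rightarrow> real measure" where
  "hybrid_measure N =
     measure_of (hybrid_set N) (sets (restrict_space borel (hybrid_set N)))
       (\<lambda>A. emeasure lborel (A \<inter> {0..1}) + (\<Sum>k=2..N+1. indicator A (real k)))"

text \<open>\<open>L2_sq v\<close> is the square of the \<open>L\<^sup>2(0,1)\<close> norm.\<close>

definition L2_sq :: "(real \<Rightarrow> real) \<Rightarrow> ennreal" where
  "L2_sq v = (\<integral>\<^sup>+x\<in>{0..1}. ennreal (\<bar>v x\<bar>\<^sup>2) \<partial>lborel)"

definition L2_space :: "(real \<Rightarrow> real) set" where
  "L2_space = {v. set_borel_measurable borel {0..1} v \<and> L2_sq v < \<infinity>}"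

text \<open>\<open>gagliardo_sq \<alpha> v\<close> is the square of the seminorm.  The quotient is \<open>0\<close> on the (null)
  diagonal, since division by \<open>0\<close> yields \<open>0\<close>.\<close>

definition gagliardo_sq :: "real \<Rightarrow> (real \<Rightarrow> real) \<Rightarrow> ennreal" where
  "gagliardo_sq \<alpha> v =
     (\<integral>\<^sup>+y\<in>{0..1}. (\<integral>\<^sup>+x\<in>{0..1}.
        ennreal (\<bar>v x - v y\<bar>\<^sup>2 / \<bar>x - y\<bar> powr (1 + 2 * \<alpha>)) \<partial>lborel) \<partial>lborel)"

definition H_space :: "real \<Rightarrow> (real \<Rightarrow> real) set" where
  "H_space \<alpha> = {v \<in> L2_space. gagliardo_sq \<alpha> v < \<infinity>}"

text \<open>The values \<open>a\<^sub>k = u (real k)\<close> are unconstrained, and membership in \<open>H_space \<alpha>\<close> only depends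
  on the restriction of \<open>u\<close> to the unit interval.\<close>

definition hybrid_space :: "nat \<Rightarrow> real \<Rightarrow> (real \<Rightarrow> real) set" where
  "hybrid_space N \<alpha> = {u \<in> hybrid_set N \<rightarrow>\<^sub>E UNIV. u \<in> H_space \<alpha>}"

definition hybrid_energy :: "nat \<Rightarrow> real \<Rightarrow> (real \<Rightarrow> real) \<Rightarrow> ennreal" where
  "hybrid_energy N \<alpha> u =
     (\<integral>\<^sup>+(x, y). (if x = y then 0
        else ennreal (\<bar>u x - u y\<bar>\<^sup>2 / \<bar>x - y\<bar> powr (1 + 2 * \<alpha>)))
      \<partial>(hybrid_measure N \<Otimes>\<^sub>M hybrid_measure N))"

definition unit_mean :: "(real \<Rightarrow> real) \<Rightarrow> real" where
  "unit_mean v = (LBINT x:{0..1}. v x)"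

text \<open>The set function in \<open>hybrid_measure_def\<close> is countably additive, so it is the measure of
  \<open>hybrid_measure N\<close>, and integration with respect to it has the expected form.\<close>

lemma space_hybrid_measure: "space (hybrid_measure N) = hybrid_set N"
  and sets_hybrid_measure:
    "sets (hybrid_measure N) = sets (restrict_space borel (hybrid_set N))"
proof -
  let ?R = "restrict_space borel (hybrid_set N)"
  have s: "space ?R = hybrid_set N"
    by (simp add: space_restrict_space)
  have p: "sets ?R \<subseteq> Pow (hybrid_set N)"
    using sets.space_closed[of ?R] unfolding s .
  show "space (hybrid_measure N) = hybrid_set N"
    unfolding hybrid_measure_def using p by (rule space_measure_of)
  show "sets (hybrid_measure N) = sets ?R"
    unfolding hybrid_measure_def sets_measure_of[OF p]
    using sets.sigma_sets_eq[of ?R] unfolding s .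
qed

lemma hybrid_set_borel: "hybrid_set N \<in> sets borel"
proof -
  have "closed (real ` {2..N+1})"
    by (intro finite_imp_closed) auto
  then show ?thesis
    unfolding hybrid_set_def by (intro sets.Un borel_closed) auto
qed

lemma emeasure_hybrid_measure:
  assumes "A \<in> sets (hybrid_measure N)"
  shows "emeasure (hybrid_measure N) A =
    emeasure lborel (A \<inter> {0..1}) + (\<Sum>k=2..N+1. indicator A (real k))"
proof -
  let ?f = "\<lambda>A. emeasure lborel (A \<inter> {0..1}) + (\<Sum>k=2..N+1. indicator A (real k)) :: ennreal"
  have ca: "countably_additive (sets (hybrid_measure N)) ?f"
  proof (rule countably_additiveI)
    fix A :: "nat \<Rightarrow> real set"
    assume A: "range A \<subseteq> sets (hybrid_measure N)" and d: "disjoint_family A"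
    have b: "A i \<in> sets borel" for i
    proof -
      have "A i \<in> sets (restrict_space borel (hybrid_set N))"
        using A by (auto simp: sets_hybrid_measure)
      then show ?thesis
        using hybrid_set_borel[of N] by (auto simp: sets_restrict_space)
    qed
    have d': "disjoint_family (\<lambda>i. A i \<inter> {0..1})"
      using d by (auto simp: disjoint_family_on_def)
    have "(\<Sum>i. emeasure lborel (A i \<inter> {0..1})) = emeasure lborel (\<Union>i. A i \<inter> {0..1})"
      using b by (intro suminf_emeasure[OF _ d']) auto
    moreover have "(\<Union>i. A i \<inter> {0..1}) = (\<Union>i. A i) \<inter> {0..1}"
      by blast
    ultimately have 1:
      "(\<Sum>i. emeasure lborel (A i \<inter> {0..1})) = emeasure lborel ((\<Union>i. A i) \<inter> {0..1})"
      by simp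
    have 2: "(\<Sum>i. \<Sum>k=2..N+1. (indicator (A i) (real k) :: ennreal))
        = (\<Sum>k=2..N+1. indicator (\<Union>i. A i) (real k))"
      by (subst suminf_sum) (simp_all only: summableI suminf_indicator[OF d])
    have "(\<Sum>i. ?f (A i)) = (\<Sum>i. emeasure lborel (A i \<inter> {0..1}))
        + (\<Sum>i. \<Sum>k=2..N+1. (indicator (A i) (real k) :: ennreal))"
      by (rule suminf_add[symmetric]) (rule summableI)+
    then show "(\<Sum>i. ?f (A i)) = ?f (\<Union>i. A i)"
      by (simp only: 1 2)
  qed
  have s: "sets (restrict_space borel (hybrid_set N)) \<subseteq> Pow (hybrid_set N)"
    by (auto simp: sets_restrict_space)
  show ?thesis
    using s ca assms
    by (intro emeasure_measure_of[OF hybrid_measure_def]) (auto simp: positive_def)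
qed

lemma measurable_hybrid_measure_unit:
  fixes f :: "real \<Rightarrow> ennreal"
  assumes "f \<in> borel_measurable (hybrid_measure N)"
  shows "(\<lambda>x. f x * indicator {0..1} x) \<in> borel_measurable borel"
proof -
  have "f \<in> borel_measurable (restrict_space borel (hybrid_set N))"
    using assms by (simp cong: measurable_cong_sets add: sets_hybrid_measure)
  then have [measurable]: "(\<lambda>x. f x * indicator (hybrid_set N) x) \<in> borel_measurable borel"
    using hybrid_set_borel[of N]
    by (subst (asm) borel_measurable_restrict_space_iff_ennreal) auto
  have "(\<lambda>x. f x * indicator (hybrid_set N) x * indicator {0..1} x) \<in> borel_measurable borel"
    by measurable
  moreover have "f x * indicator (hybrid_set N) x * indicator {0..1} x = f x * indicator {0..1} x"
    for x
    by (simp add: hybrid_set_def split: split_indicator)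
  ultimately show ?thesis
    by (simp only:)
qed

lemma nn_integral_hybrid_measure:
  fixes f :: "real \<Rightarrow> ennreal"
  assumes "f \<in> borel_measurable (hybrid_measure N)"
  shows "(\<integral>\<^sup>+x. f x \<partial>hybrid_measure N) =
    (\<integral>\<^sup>+x\<in>{0..1}. f x \<partial>lborel) + (\<Sum>k=2..N+1. f (real k))"
  using assms
proof (induct rule: borel_measurable_induct)
  case (cong f g)
  have e: "f x = g x" if "x \<in> {0..1} \<union> real ` {2..N+1}" for x
    using cong(3) that by (simp add: space_hybrid_measure hybrid_set_def)
  have "(\<integral>\<^sup>+x\<in>{0..1}. f x \<partial>lborel) = (\<integral>\<^sup>+x\<in>{0..1}. g x \<partial>lborel)"
    by (intro nn_integral_cong) (simp add: e split: split_indicator)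
  moreover have "(\<Sum>k=2..N+1. f (real k)) = (\<Sum>k=2..N+1. g (real k))"
    by (intro sum.cong refl e) blast
  moreover have "(\<integral>\<^sup>+x. f x \<partial>hybrid_measure N) = (\<integral>\<^sup>+x. g x \<partial>hybrid_measure N)"
    using cong(3) by (rule nn_integral_cong)
  ultimately show ?case using cong(4) by (simp only:)
next
  case (set A)
  have "A \<in> sets (restrict_space borel (hybrid_set N))"
    using set by (simp add: sets_hybrid_measure)
  then have "A \<in> sets borel"
    using hybrid_set_borel[of N] by (auto simp: sets_restrict_space)
  then have "(\<integral>\<^sup>+x\<in>{0..1}. indicator A x \<partial>lborel) = emeasure lborel (A \<inter> {0..1})"
    by (simp flip: indicator_inter_arith)
  then show ?case
    using set by (simp only: emeasure_hybrid_measure nn_integral_indicator)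
next
  case (mult f c)
  have "(\<integral>\<^sup>+x\<in>{0..1}. c * f x \<partial>lborel) = c * (\<integral>\<^sup>+x\<in>{0..1}. f x \<partial>lborel)"
    using measurable_hybrid_measure_unit[OF mult(2)]
    by (subst nn_integral_cmult[symmetric]) (simp_all add: mult.assoc)
  moreover have "(\<integral>\<^sup>+x. c * f x \<partial>hybrid_measure N) = c * (\<integral>\<^sup>+x. f x \<partial>hybrid_measure N)"
    using mult(2) by (rule nn_integral_cmult)
  ultimately show ?case
    using mult(4) by (simp only: distrib_left sum_distrib_left)
next
  case (add f g)
  have "(\<integral>\<^sup>+x\<in>{0..1}. (g x + f x) \<partial>lborel)
      = (\<integral>\<^sup>+x\<in>{0..1}. g x \<partial>lborel) + (\<integral>\<^sup>+x\<in>{0..1}. f x \<partial>lborel)"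
    using add(1,4)[THEN measurable_hybrid_measure_unit]
    by (subst nn_integral_add[symmetric]) (simp_all add: distrib_right)
  moreover have "(\<integral>\<^sup>+x. g x + f x \<partial>hybrid_measure N)
      = (\<integral>\<^sup>+x. g x \<partial>hybrid_measure N) + (\<integral>\<^sup>+x. f x \<partial>hybrid_measure N)"
    using add(4,1) by (rule nn_integral_add)
  ultimately show ?case
    using add(3,7) by (simp only: sum.distrib add_ac)
next
  case (seq U)
  have i: "incseq (\<lambda>i. U i x)" for x
    using seq(4) by (simp add: incseq_def le_fun_def)
  have i': "incseq (\<lambda>i x. U i x * indicator {0..1} x)"
    using seq(4) by (auto simp: incseq_def le_fun_def intro: mult_right_mono)
  have "(\<integral>\<^sup>+x\<in>{0..1}. (SUP i. U i) x \<partial>lborel) = (\<integral>\<^sup>+x. (SUP i. U i x * indicator {0..1} x) \<partial>lborel)"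
    by (intro nn_integral_cong) (simp only: SUP_apply SUP_mult_right_ennreal image_comp o_def)
  also have "\<dots> = (SUP i. \<integral>\<^sup>+x\<in>{0..1}. U i x \<partial>lborel)"
    using measurable_hybrid_measure_unit[OF seq(1)] i'
    by (intro nn_integral_monotone_convergence_SUP) simp_all
  finally have 1: "(\<integral>\<^sup>+x\<in>{0..1}. (SUP i. U i) x \<partial>lborel) = \<dots>" .
  have 2: "(\<Sum>k=2..N+1. (SUP i. U i) (real k)) = (SUP i. \<Sum>k=2..N+1. U i (real k))"
    unfolding SUP_apply by (rule ennreal_SUP_sum[symmetric]) (rule i)
  have "(\<integral>\<^sup>+x. (SUP i. U i) x \<partial>hybrid_measure N) = (SUP i. \<integral>\<^sup>+x. U i x \<partial>hybrid_measure N)"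
    unfolding SUP_apply using seq(4,1) by (rule nn_integral_monotone_convergence_SUP)
  also have "\<dots> = (SUP i. (\<integral>\<^sup>+x\<in>{0..1}. U i x \<partial>lborel) + (\<Sum>k=2..N+1. U i (real k)))"
    using seq(3) by (simp only:)
  also have "\<dots> = (SUP i. \<integral>\<^sup>+x\<in>{0..1}. U i x \<partial>lborel) + (SUP i. \<Sum>k=2..N+1. U i (real k))"
  proof (rule ennreal_SUP_add)
    show "incseq (\<lambda>i. \<integral>\<^sup>+x\<in>{0..1}. U i x \<partial>lborel)"
      using i' by (auto simp: incseq_def le_fun_def intro!: nn_integral_mono)
    show "incseq (\<lambda>i. \<Sum>k=2..N+1. U i (real k))"
      using i by (intro incseq_sumI2)
  qed
  finally show ?case by (simp only: 1 2)
qed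

end

theory Submission
  imports Defs
begin

text \<open>
  The energy splits into the Gagliardo term, the interaction of the interval with the isolated
  points, and the interaction among the isolated points.  All distances in the last two parts lie
  in \<open>[1, N + 1]\<close>, so up to constants the kernel can be dropped there.  The mixed part is then
  controlled from both sides by \<open>\<integral> (v - a)\<^sup>2 = \<integral> (v - vbar)\<^sup>2 + (a - vbar)\<^sup>2\<close>, and the last part is
  bounded by \<open>(a\<^sub>j - a\<^sub>k)\<^sup>2 \<le> 2 (a\<^sub>j - vbar)\<^sup>2 + 2 (a\<^sub>k - vbar)\<^sup>2\<close>.
\<close>

section \<open>Integration against the product of two hybrid measures\<close>

text \<open>Supplies the sigma-finiteness that Tonelli's theorem needs for the product measure. The
  interval contributes at most 1 to the total mass and each of the finitely many points contributes
  1.\<close>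

lemma finite_measure_hybrid_measure: "finite_measure (hybrid_measure N)"
proof (rule finite_measureI)
  have "emeasure lborel (hybrid_set N \<inter> {0..1}) \<le> emeasure lborel {0..1::real}"
    by (intro emeasure_mono) auto
  then have "emeasure lborel (hybrid_set N \<inter> {0..1}) \<noteq> \<infinity>"
    by (auto simp: top_unique)
  moreover have "(\<Sum>k=2..N+1. indicator (hybrid_set N) (real k)) \<noteq> (\<infinity> :: ennreal)"
    by (simp add: indicator_def)
  ultimately show "emeasure (hybrid_measure N) (space (hybrid_measure N)) \<noteq> \<infinity>"
    by (subst emeasure_hybrid_measure[OF sets.top]) (simp add: space_hybrid_measure)
qed

lemma real_in_hybrid_set: "k \<in> {2..N+1} \<Longrightarrow> real k \<in> hybrid_set N"
  by (simp add: hybrid_set_def)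

text \<open>Tonelli turns the double integral into an iterated one, and
  \<open>nn_integral_hybrid_measure\<close> is then applied in each variable. The four terms are the
  interval-interval, interval-point, point-interval and point-point interactions.\<close>

lemma nn_integral_hybrid_measure_pair:
  fixes f :: "real \<times> real \<Rightarrow> ennreal"
  assumes f: "f \<in> borel_measurable (hybrid_measure N \<Otimes>\<^sub>M hybrid_measure N)"
  shows "(\<integral>\<^sup>+z. f z \<partial>(hybrid_measure N \<Otimes>\<^sub>M hybrid_measure N)) =
    (\<integral>\<^sup>+x\<in>{0..1}. (\<integral>\<^sup>+y\<in>{0..1}. f (x, y) \<partial>lborel) \<partial>lborel)
    + (\<Sum>k=2..N+1. \<integral>\<^sup>+x\<in>{0..1}. f (x, real k) \<partial>lborel)
    + (\<Sum>k=2..N+1. \<integral>\<^sup>+y\<in>{0..1}. f (real k, y) \<partial>lborel)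
    + (\<Sum>j=2..N+1. \<Sum>k=2..N+1. f (real j, real k))"
proof -
  let ?H = "hybrid_measure N"
  interpret finite_measure ?H by (rule finite_measure_hybrid_measure)
  have sec1: "(\<lambda>y. f (x, y)) \<in> borel_measurable ?H" if "x \<in> hybrid_set N" for x
    using f that by (intro measurable_Pair2[where x=x]) (auto simp: space_hybrid_measure)
  have sec2: "(\<lambda>x. f (x, y)) \<in> borel_measurable ?H" if "y \<in> hybrid_set N" for y
    using f that by (intro measurable_Pair1[where y=y]) (auto simp: space_hybrid_measure)
  have inner: "(\<integral>\<^sup>+y. f (x, y) \<partial>?H)
      = (\<integral>\<^sup>+y\<in>{0..1}. f (x, y) \<partial>lborel) + (\<Sum>k=2..N+1. f (x, real k))"
    if "x \<in> hybrid_set N" for x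
    using sec1[OF that] by (rule nn_integral_hybrid_measure)
  have meas: "(\<lambda>x. \<integral>\<^sup>+y. f (x, y) \<partial>?H) \<in> borel_measurable ?H"
    using f by (rule borel_measurable_nn_integral_fst)
  have msum: "(\<lambda>x. \<Sum>k=2..N+1. f (x, real k)) \<in> borel_measurable ?H"
    by (intro borel_measurable_sum sec2 real_in_hybrid_set)
  have I: "x \<in> hybrid_set N" if "x \<in> {0..1}" for x
    using that by (simp add: hybrid_set_def)
  have sub: "{0..1} \<in> sets ?H"
    unfolding sets_hybrid_measure sets_restrict_space
    by (intro image_eqI[where x="{0..1}"]) (auto simp: hybrid_set_def)
  have ind: "(indicator {0..1} :: real \<Rightarrow> ennreal) \<in> borel_measurable ?H"
    using sub by (rule borel_measurable_indicator)
  \<comment> \<open>Measurability of the inner Lebesgue integral in \<open>x\<close>: it is a hybrid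
    integral in disguise. Cutting \<open>f\<close> off by the indicator of the interval in the
    second coordinate removes the point masses, since every \<open>real k\<close> with
    \<open>k \<ge> 2\<close> lies outside the interval.\<close>
  have "(\<lambda>z. f z * indicator {0..1} (snd z)) \<in> borel_measurable (?H \<Otimes>\<^sub>M ?H)"
    by (intro borel_measurable_times_ennreal f measurable_compose[OF measurable_snd ind])
  from borel_measurable_nn_integral_fst[OF this]
  have "(\<lambda>x. \<integral>\<^sup>+y. f (x, y) * indicator {0..1} y \<partial>?H) \<in> borel_measurable ?H"
    by simp
  moreover have "(\<integral>\<^sup>+y. f (x, y) * indicator {0..1} y \<partial>?H) = (\<integral>\<^sup>+y\<in>{0..1}. f (x, y) \<partial>lborel)"
    if "x \<in> hybrid_set N" for x
  proof -
    have "(\<Sum>k=2..N+1. f (x, real k) * indicator {0..1} (real k)) = 0"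
      by (intro sum.neutral) auto
    moreover have "(\<lambda>y. f (x, y) * indicator {0..1} y) \<in> borel_measurable ?H"
      by (intro borel_measurable_times_ennreal sec1[OF that] ind)
    ultimately show ?thesis
      by (subst nn_integral_hybrid_measure) (simp_all add: mult.assoc flip: indicator_inter_arith)
  qed
  ultimately have mint: "(\<lambda>x. \<integral>\<^sup>+y\<in>{0..1}. f (x, y) \<partial>lborel) \<in> borel_measurable ?H"
    by (subst measurable_cong) (auto simp: space_hybrid_measure)
  have "(\<integral>\<^sup>+z. f z \<partial>(?H \<Otimes>\<^sub>M ?H)) = (\<integral>\<^sup>+x. \<integral>\<^sup>+y. f (x, y) \<partial>?H \<partial>?H)"
    using nn_integral_fst[OF f] by simp
  also have "\<dots> = (\<integral>\<^sup>+x\<in>{0..1}. (\<integral>\<^sup>+y. f (x, y) \<partial>?H) \<partial>lborel)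
      + (\<Sum>j=2..N+1. \<integral>\<^sup>+y. f (real j, y) \<partial>?H)"
    using meas by (rule nn_integral_hybrid_measure)
  also have "(\<Sum>j=2..N+1. \<integral>\<^sup>+y. f (real j, y) \<partial>?H)
      = (\<Sum>k=2..N+1. \<integral>\<^sup>+y\<in>{0..1}. f (real k, y) \<partial>lborel)
        + (\<Sum>j=2..N+1. \<Sum>k=2..N+1. f (real j, real k))"
    unfolding sum.distrib[symmetric] by (intro sum.cong refl inner real_in_hybrid_set)
  also have "(\<integral>\<^sup>+x\<in>{0..1}. (\<integral>\<^sup>+y. f (x, y) \<partial>?H) \<partial>lborel)
      = (\<integral>\<^sup>+x. (\<integral>\<^sup>+y\<in>{0..1}. f (x, y) \<partial>lborel) * indicator {0..1} x
          + (\<Sum>k=2..N+1. f (x, real k)) * indicator {0..1} x \<partial>lborel)"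
  \<comment> \<open>Here \<open>x\<close> ranges over all reals, while \<open>inner\<close> holds on
    the hybrid set; outside the interval the indicator makes both sides 0.\<close>
  proof (intro nn_integral_cong)
    fix x :: real
    show "(\<integral>\<^sup>+y. f (x, y) \<partial>?H) * indicator {0..1} x
        = (\<integral>\<^sup>+y\<in>{0..1}. f (x, y) \<partial>lborel) * indicator {0..1} x
          + (\<Sum>k=2..N+1. f (x, real k)) * indicator {0..1} x"
      unfolding distrib_right[symmetric]
      by (cases "x \<in> {0..1}") (simp_all only: I inner indicator_simps mult_zero_right not_False_eq_True)
  qed
  also have "\<dots> = (\<integral>\<^sup>+x\<in>{0..1}. (\<integral>\<^sup>+y\<in>{0..1}. f (x, y) \<partial>lborel) \<partial>lborel)
      + (\<integral>\<^sup>+x\<in>{0..1}. (\<Sum>k=2..N+1. f (x, real k)) \<partial>lborel)"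
    by (intro nn_integral_add)
       (simp_all only: measurable_lborel2 measurable_hybrid_measure_unit[OF mint]
         measurable_hybrid_measure_unit[OF msum])
  also have "(\<integral>\<^sup>+x\<in>{0..1}. (\<Sum>k=2..N+1. f (x, real k)) \<partial>lborel)
      = (\<Sum>k=2..N+1. \<integral>\<^sup>+x\<in>{0..1}. f (x, real k) \<partial>lborel)"
    unfolding sum_distrib_right
    using measurable_hybrid_measure_unit[OF sec2[OF real_in_hybrid_set]]
    by (intro nn_integral_sum) simp
  finally show ?thesis by (simp only: add.assoc)
qed

section \<open>Measurability on the hybrid set\<close>

text \<open>Finitely many point values cannot spoil measurability: on the hybrid set,
  \<open>u\<close> agrees with its cut-off to the interval plus a finite combination of indicators
  of singletons, which is Borel on the whole line.\<close>

lemma measurable_hybrid_measure: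
  fixes u :: "real \<Rightarrow> real"
  assumes "set_borel_measurable borel {0..1} u"
  shows "u \<in> borel_measurable (hybrid_measure N)"
proof -
  let ?D = "real ` {2..N+1}"
  have [measurable]: "(\<lambda>x. indicator {0..1} x *\<^sub>R u x) \<in> borel_measurable borel"
    using assms unfolding set_borel_measurable_def .
  have "(\<lambda>x. indicator {0..1} x *\<^sub>R u x + (\<Sum>k=2..N+1. u (real k) * indicator {real k} x))
      \<in> borel_measurable (restrict_space borel (hybrid_set N))"
    by (intro measurable_restrict_space1) measurable
  moreover have
    "indicator {0..1} x *\<^sub>R u x + (\<Sum>k=2..N+1. u (real k) * indicator {real k} x) = u x"
    if "x \<in> hybrid_set N" for x
  proof (cases "x \<in> {0..1}")
    case True
    then have "(\<Sum>k=2..N+1. u (real k) * indicator {real k} x) = 0"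
      by (intro sum.neutral) auto
    with True show ?thesis by simp
  next
    case False
    then obtain j where j: "j \<in> {2..N+1}" "x = real j"
      using \<open>x \<in> hybrid_set N\<close> by (auto simp: hybrid_set_def)
    have "(\<Sum>k=2..N+1. u (real k) * indicator {real k} x)
        = (\<Sum>k=2..N+1. if k = j then u (real k) else 0)"
      using j by (intro sum.cong) auto
    with False j show ?thesis by simp
  qed
  ultimately have "u \<in> borel_measurable (restrict_space borel (hybrid_set N))"
    by (subst measurable_cong[where g="\<lambda>x. indicator {0..1} x *\<^sub>R u x
          + (\<Sum>k=2..N+1. u (real k) * indicator {real k} x)"])
       (simp_all add: space_restrict_space)
  then show ?thesis
    by (simp cong: measurable_cong_sets add: sets_hybrid_measure)
qed

lemma ident_measurable_hybrid_measure: "(\<lambda>x. x) \<in> borel_measurable (hybrid_measure N)"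
  by (rule measurable_hybrid_measure) (simp add: set_borel_measurable_def)

section \<open>Variance identity on the unit interval\<close>

text \<open>Expand the square around the mean: the cross term integrates to 0 because the interval
  has length 1. The identity converts distances from \<open>v\<close> to a point value
  \<open>a\<close> into exactly the quantities compared in the theorem.\<close>

lemma L2_sq_diff_const:
  assumes "v \<in> L2_space"
  shows "L2_sq (\<lambda>x. v x - a) = L2_sq (\<lambda>x. v x - unit_mean v) + ennreal (\<bar>a - unit_mean v\<bar>\<^sup>2)"
proof -
  let ?I = "{0..1::real}" and ?m = "unit_mean v"
  have vm: "set_borel_measurable borel ?I v" and fin: "L2_sq v < \<infinity>"
    using assms by (auto simp: L2_space_def)
  have one: "set_integrable lborel ?I (\<lambda>x. c)" for c :: real
    by (simp add: set_integrable_def)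
  have vm': "(\<lambda>x. indicator ?I x *\<^sub>R v x) \<in> borel_measurable borel"
    using vm unfolding set_borel_measurable_def .
  then have "(\<lambda>x. (indicator ?I x *\<^sub>R v x)\<^sup>2) \<in> borel_measurable borel"
    by measurable
  also have "(\<lambda>x. (indicator ?I x *\<^sub>R v x)\<^sup>2) = (\<lambda>x. indicator ?I x *\<^sub>R (v x)\<^sup>2)"
    by (intro ext) (simp split: split_indicator)
  finally have sq_meas: "(\<lambda>x. indicator ?I x *\<^sub>R (v x)\<^sup>2) \<in> borel_measurable borel" .
  have sq: "set_integrable lborel ?I (\<lambda>x. (v x)\<^sup>2)"
    unfolding set_integrable_def
  proof (rule integrableI_nonneg)
    have "(\<integral>\<^sup>+x. ennreal (indicator ?I x *\<^sub>R (v x)\<^sup>2) \<partial>lborel) = L2_sq v"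
      unfolding L2_sq_def by (intro nn_integral_cong) (simp split: split_indicator)
    with fin show "(\<integral>\<^sup>+x. ennreal (indicator ?I x *\<^sub>R (v x)\<^sup>2) \<partial>lborel) < \<infinity>" by simp
  qed (use sq_meas in auto)
  \<comment> \<open>Square integrability on a set of finite measure gives integrability, through the
    majorant \<open>1 + (v x)\<^sup>2\<close>. Without it the Bochner integral in
    \<open>unit_mean\<close> could be the default value 0 instead of the mean.\<close>
  have "set_integrable lborel ?I (\<lambda>x. 1 + (v x)\<^sup>2)"
    using one sq by (rule set_integral_add)
  then have v: "set_integrable lborel ?I v"
  proof (rule set_integrable_bound)
    show "set_borel_measurable lborel ?I v"
      using vm by (simp add: set_borel_measurable_def)
    have "\<bar>t\<bar> \<le> 1 + t\<^sup>2" for t :: real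
      using zero_le_power2[of "\<bar>t\<bar> - 1"] by (simp add: power2_diff)
    then show "AE x in lborel. x \<in> ?I \<longrightarrow> norm (v x) \<le> norm (1 + (v x)\<^sup>2)"
      by (intro AE_I2) (simp add: abs_of_nonneg)
  qed
  have sqd: "set_integrable lborel ?I (\<lambda>x. (v x - c)\<^sup>2)" for c
  proof -
    have "set_integrable lborel ?I (\<lambda>x. (v x)\<^sup>2 - 2 * c * v x + c\<^sup>2)"
      by (intro set_integral_add set_integral_diff sq one set_integrable_mult_right v)
    then show ?thesis by (simp add: power2_diff mult_ac diff_add_eq)
  qed
  \<comment> \<open>The computation moves to real-valued integrals because the cross term changes
    sign and has no meaning in \<open>ennreal\<close>.\<close>
  have L2: "L2_sq (\<lambda>x. v x - c) = ennreal (LBINT x:?I. (v x - c)\<^sup>2)" for c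
  proof -
    have "L2_sq (\<lambda>x. v x - c) = (\<integral>\<^sup>+x. ennreal (indicator ?I x *\<^sub>R (v x - c)\<^sup>2) \<partial>lborel)"
      unfolding L2_sq_def by (intro nn_integral_cong) (simp split: split_indicator)
    also have "\<dots> = ennreal (LBINT x:?I. (v x - c)\<^sup>2)"
      unfolding set_lebesgue_integral_def
      using sqd by (intro nn_integral_eq_integral) (auto simp: set_integrable_def)
    finally show ?thesis .
  qed
  have const: "(LBINT x:?I. c) = c" for c :: real
    by (simp add: set_lebesgue_integral_def)
  have "(LBINT x:?I. (v x - a)\<^sup>2)
      = (LBINT x:?I. (v x - ?m)\<^sup>2 + (2 * (?m - a) * (v x - ?m) + (a - ?m)\<^sup>2))"
    by (intro set_lebesgue_integral_cong) (auto simp: power2_eq_square algebra_simps)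
  also have "\<dots> = (LBINT x:?I. (v x - ?m)\<^sup>2)
      + (LBINT x:?I. 2 * (?m - a) * (v x - ?m) + (a - ?m)\<^sup>2)"
    by (intro set_integral_add sqd one set_integrable_mult_right set_integral_diff v)
  also have "(LBINT x:?I. 2 * (?m - a) * (v x - ?m) + (a - ?m)\<^sup>2)
      = (LBINT x:?I. 2 * (?m - a) * (v x - ?m)) + (LBINT x:?I. (a - ?m)\<^sup>2)"
    by (intro set_integral_add one set_integrable_mult_right set_integral_diff v)
  \<comment> \<open>The integral of the constant \<open>?m\<close> over the unit interval is
    \<open>?m\<close>, which is also the integral of \<open>v\<close>.\<close>
  also have "(LBINT x:?I. 2 * (?m - a) * (v x - ?m)) = 0"
    using set_integral_diff(2)[OF v one[of ?m]] const[of ?m] by (simp add: unit_mean_def)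
  finally have "(LBINT x:?I. (v x - a)\<^sup>2) = (LBINT x:?I. (v x - ?m)\<^sup>2) + \<bar>a - ?m\<bar>\<^sup>2"
    by (simp add: const)
  moreover have "(LBINT x:?I. (v x - ?m)\<^sup>2) \<ge> 0"
    by (simp add: set_lebesgue_integral_def)
  ultimately show ?thesis
    by (simp only: L2 ennreal_plus zero_le_power2)
qed

section \<open>The kernel quotient and the splitting of the energy\<close>

text \<open>On the diagonal the value is 0, which matches the case distinction in
  \<open>hybrid_energy\<close>. Being real-valued, it can be estimated before the passage to
  \<open>ennreal\<close>.\<close>

definition gagliardo_quotient :: "real \<Rightarrow> (real \<Rightarrow> real) \<Rightarrow> real \<Rightarrow> real \<Rightarrow> real" where
  "gagliardo_quotient \<alpha> u x y = \<bar>u x - u y\<bar>\<^sup>2 / \<bar>x - y\<bar> powr (1 + 2 * \<alpha>)"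

lemma gagliardo_quotient_commute: "gagliardo_quotient \<alpha> u x y = gagliardo_quotient \<alpha> u y x"
  by (simp add: gagliardo_quotient_def abs_minus_commute)

lemma gagliardo_quotient_le:
  assumes "0 < \<alpha>" and "1 \<le> \<bar>x - y\<bar>"
  shows "gagliardo_quotient \<alpha> u x y \<le> \<bar>u x - u y\<bar>\<^sup>2"
proof -
  have "1 \<le> \<bar>x - y\<bar> powr (1 + 2 * \<alpha>)"
    using assms by (intro ge_one_powr_ge_zero) auto
  then have "\<bar>u x - u y\<bar>\<^sup>2 / \<bar>x - y\<bar> powr (1 + 2 * \<alpha>) \<le> \<bar>u x - u y\<bar>\<^sup>2 / 1"
    by (intro divide_left_mono) auto
  then show ?thesis by (simp add: gagliardo_quotient_def)
qed

text \<open>The exponent is positive, so the largest admissible distance \<open>R\<close> gives the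
  largest denominator. The lemma is applied with \<open>R = N + 1\<close>.\<close>

lemma gagliardo_quotient_ge:
  assumes "0 < \<alpha>" and "x \<noteq> y" and "\<bar>x - y\<bar> \<le> R"
  shows "R powr - (1 + 2 * \<alpha>) * \<bar>u x - u y\<bar>\<^sup>2 \<le> gagliardo_quotient \<alpha> u x y"
proof -
  have "\<bar>x - y\<bar> powr (1 + 2 * \<alpha>) \<le> R powr (1 + 2 * \<alpha>)"
    using assms by (intro powr_mono2) auto
  then have "\<bar>u x - u y\<bar>\<^sup>2 / R powr (1 + 2 * \<alpha>) \<le> \<bar>u x - u y\<bar>\<^sup>2 / \<bar>x - y\<bar> powr (1 + 2 * \<alpha>)"
    using assms by (intro divide_left_mono mult_pos_pos) auto
  then show ?thesis
    unfolding gagliardo_quotient_def powr_minus divide_inverse by (simp add: mult.commute)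
qed

text \<open>The kernel is symmetric, so the interval-point and point-interval terms coincide; hence
  the factor 2.\<close>

lemma hybrid_energy_split:
  assumes "set_borel_measurable borel {0..1} u"
  shows "hybrid_energy N \<alpha> u = gagliardo_sq \<alpha> u
    + 2 * (\<Sum>k=2..N+1. \<integral>\<^sup>+x\<in>{0..1}. ennreal (gagliardo_quotient \<alpha> u x (real k)) \<partial>lborel)
    + (\<Sum>j=2..N+1. \<Sum>k=2..N+1. ennreal (gagliardo_quotient \<alpha> u (real j) (real k)))"
proof -
  let ?q = "gagliardo_quotient \<alpha> u"
  have [measurable]: "u \<in> borel_measurable (hybrid_measure N)"
      "(\<lambda>x. x) \<in> borel_measurable (hybrid_measure N)"
    by (rule measurable_hybrid_measure[OF assms], rule ident_measurable_hybrid_measure)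
  \<comment> \<open>The kernel contains \<open>x - y\<close>, so the coordinates have to be Borel
    functions for the product of the hybrid sigma-algebras.\<close>
  have [measurable]: "fst \<in> borel_measurable (hybrid_measure N \<Otimes>\<^sub>M hybrid_measure N)"
    "snd \<in> borel_measurable (hybrid_measure N \<Otimes>\<^sub>M hybrid_measure N)"
    using measurable_compose[OF measurable_fst ident_measurable_hybrid_measure]
      measurable_compose[OF measurable_snd ident_measurable_hybrid_measure] by simp_all
  have meas: "(\<lambda>z. ennreal (?q (fst z) (snd z)))
      \<in> borel_measurable (hybrid_measure N \<Otimes>\<^sub>M hybrid_measure N)"
    unfolding gagliardo_quotient_def by measurable
  \<comment> \<open>In \<open>gagliardo_sq\<close> the outer variable is the second argument of the
    quotient; symmetry and renaming bound variables suffice, with no exchange of integrals.\<close>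
  have flip_G:
    "(\<integral>\<^sup>+x\<in>{0..1}. (\<integral>\<^sup>+y\<in>{0..1}. ennreal (?q x y) \<partial>lborel) \<partial>lborel) = gagliardo_sq \<alpha> u"
    unfolding gagliardo_sq_def gagliardo_quotient_def[symmetric]
    by (subst gagliardo_quotient_commute) (rule refl)
  have flip_X: "(\<integral>\<^sup>+y\<in>{0..1}. ennreal (?q (real k) y) \<partial>lborel)
      = (\<integral>\<^sup>+x\<in>{0..1}. ennreal (?q x (real k)) \<partial>lborel)" for k
    by (subst gagliardo_quotient_commute) (rule refl)
  have "hybrid_energy N \<alpha> u
      = (\<integral>\<^sup>+z. ennreal (?q (fst z) (snd z)) \<partial>(hybrid_measure N \<Otimes>\<^sub>M hybrid_measure N))"
    unfolding hybrid_energy_def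
    by (intro nn_integral_cong) (auto simp: gagliardo_quotient_def)
  also have "\<dots> = gagliardo_sq \<alpha> u
    + (\<Sum>k=2..N+1. \<integral>\<^sup>+x\<in>{0..1}. ennreal (?q x (real k)) \<partial>lborel)
    + (\<Sum>k=2..N+1. \<integral>\<^sup>+x\<in>{0..1}. ennreal (?q x (real k)) \<partial>lborel)
    + (\<Sum>j=2..N+1. \<Sum>k=2..N+1. ennreal (?q (real j) (real k)))"
    unfolding nn_integral_hybrid_measure_pair[OF meas] fst_conv snd_conv
    by (simp only: flip_G flip_X)
  finally show ?thesis by (simp add: mult_2 add.assoc)
qed

section \<open>Estimates for the mixed and the discrete part\<close>

text \<open>A point of the interval is at distance at least 1 from \<open>k \<ge> 2\<close>, so the
  denominator is at least 1.\<close>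

lemma set_nn_integral_gagliardo_quotient_le:
  assumes "0 < \<alpha>" and "2 \<le> k"
  shows "(\<integral>\<^sup>+x\<in>{0..1}. ennreal (gagliardo_quotient \<alpha> u x (real k)) \<partial>lborel)
    \<le> L2_sq (\<lambda>x. u x - u (real k))"
  unfolding L2_sq_def
proof (intro nn_integral_mono)
  fix x :: real
  have "gagliardo_quotient \<alpha> u x (real k) \<le> \<bar>u x - u (real k)\<bar>\<^sup>2" if "x \<in> {0..1}"
    using assms that by (intro gagliardo_quotient_le) auto
  then show "ennreal (gagliardo_quotient \<alpha> u x (real k)) * indicator {0..1} x
      \<le> ennreal (\<bar>u x - u (real k)\<bar>\<^sup>2) * indicator {0..1} x"
    by (simp add: ennreal_leI split: split_indicator)
qed

lemma set_nn_integral_gagliardo_quotient_ge: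
  assumes "0 < \<alpha>" and "2 \<le> k" and "real k \<le> R" and "set_borel_measurable borel {0..1} u"
  shows "ennreal (R powr - (1 + 2 * \<alpha>)) * L2_sq (\<lambda>x. u x - u (real k))
    \<le> (\<integral>\<^sup>+x\<in>{0..1}. ennreal (gagliardo_quotient \<alpha> u x (real k)) \<partial>lborel)"
proof -
  let ?f = "\<lambda>x. ennreal (\<bar>u x - u (real k)\<bar>\<^sup>2) * indicator {0..1} x"
  have [measurable]: "(\<lambda>x. indicator {0..1} x *\<^sub>R u x) \<in> borel_measurable borel"
    using assms(4) unfolding set_borel_measurable_def .
  \<comment> \<open>Pulling the constant out of the integral needs a measurable integrand on the
    whole line. Since \<open>u\<close> is known to be Borel only on the interval, its cut-off is
    used; the outer indicator hides the difference.\<close>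
  have "(\<lambda>x. ennreal (\<bar>indicator {0..1} x *\<^sub>R u x - u (real k)\<bar>\<^sup>2) * indicator {0..1} x)
      \<in> borel_measurable lborel"
    by measurable
  also have "(\<lambda>x. ennreal (\<bar>indicator {0..1} x *\<^sub>R u x - u (real k)\<bar>\<^sup>2) * indicator {0..1} x) = ?f"
    by (intro ext) (simp split: split_indicator)
  finally have "ennreal (R powr - (1 + 2 * \<alpha>)) * L2_sq (\<lambda>x. u x - u (real k))
      = (\<integral>\<^sup>+x. ennreal (R powr - (1 + 2 * \<alpha>)) * ?f x \<partial>lborel)"
    unfolding L2_sq_def by (rule nn_integral_cmult[symmetric])
  also have "\<dots> \<le> (\<integral>\<^sup>+x\<in>{0..1}. ennreal (gagliardo_quotient \<alpha> u x (real k)) \<partial>lborel)"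
  proof (intro nn_integral_mono)
    fix x :: real
    show "ennreal (R powr - (1 + 2 * \<alpha>)) * ?f x
        \<le> ennreal (gagliardo_quotient \<alpha> u x (real k)) * indicator {0..1} x"
    proof (cases "x \<in> {0..1}")
      case True
      then have "R powr - (1 + 2 * \<alpha>) * \<bar>u x - u (real k)\<bar>\<^sup>2 \<le> gagliardo_quotient \<alpha> u x (real k)"
        using assms by (intro gagliardo_quotient_ge) auto
      with True show ?thesis
        by (simp add: ennreal_leI flip: ennreal_mult)
    qed simp
  qed
  finally show ?thesis .
qed

lemma sum_gagliardo_quotient_le:
  assumes "0 < \<alpha>"
  shows "(\<Sum>j=2..N+1. \<Sum>k=2..N+1. gagliardo_quotient \<alpha> u (real j) (real k))
    \<le> 4 * real N * (\<Sum>k=2..N+1. \<bar>u (real k) - m\<bar>\<^sup>2)"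
proof -
  let ?b = "\<lambda>k. \<bar>u (real k) - m\<bar>\<^sup>2"
  have "gagliardo_quotient \<alpha> u (real j) (real k) \<le> 2 * ?b j + 2 * ?b k" for j k
  proof (cases "j = k")
    case True
    then show ?thesis by (simp add: gagliardo_quotient_def)
  next
    case False
    then have "gagliardo_quotient \<alpha> u (real j) (real k) \<le> \<bar>u (real j) - u (real k)\<bar>\<^sup>2"
      using assms by (intro gagliardo_quotient_le) auto
    also have "\<dots> \<le> 2 * ?b j + 2 * ?b k"
      \<comment> \<open>With \<open>s\<close> and \<open>t\<close> the two deviations from
        \<open>m\<close>, \<open>(s + t)\<^sup>2 \<ge> 0\<close> is the same as
        \<open>(s - t)\<^sup>2 \<le> 2 * s\<^sup>2 + 2 * t\<^sup>2\<close>.\<close>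
      using zero_le_power2[of "(u (real j) - m) + (u (real k) - m)"]
      by (simp add: power2_eq_square algebra_simps)
    finally show ?thesis .
  qed
  then have "(\<Sum>j=2..N+1. \<Sum>k=2..N+1. gagliardo_quotient \<alpha> u (real j) (real k))
      \<le> (\<Sum>j=2..N+1. \<Sum>k=2..N+1. 2 * ?b j + 2 * ?b k)"
    by (intro sum_mono)
  \<comment> \<open>The index set has \<open>N\<close> elements, so each of the two summands
    contributes \<open>2 * N\<close> times the single sum.\<close>
  also have "\<dots> = 4 * real N * (\<Sum>k=2..N+1. ?b k)"
    by (simp add: sum.distrib flip: sum_distrib_left)
  finally show ?thesis .
qed

section \<open>Assembling the two-sided estimate\<close>

theorem theorem2p6:
  fixes N :: nat and \<alpha> :: real
  assumes "N \<ge> 2" and "0 < \<alpha>" and "\<alpha> < 1"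
  shows "\<exists>C1 C2 :: real. C1 > 0 \<and> C2 > 0 \<and>
    (\<forall>u \<in> hybrid_space N \<alpha>.
       let vbar = unit_mean u;
           Q = gagliardo_sq \<alpha> u + L2_sq (\<lambda>x. u x - vbar)
               + (\<Sum>k=2..N+1. ennreal (\<bar>u (real k) - vbar\<bar>\<^sup>2))
       in ennreal C1 * Q \<le> hybrid_energy N \<alpha> u \<and> hybrid_energy N \<alpha> u \<le> ennreal C2 * Q)"
proof -
  \<comment> \<open>The largest distance between the interval and an isolated point is
    \<open>N + 1\<close>, attained by 0 and \<open>N + 1\<close>; \<open>c\<close> is the kernel at
    that distance.\<close>
  define c where "c = real (N + 1) powr - (1 + 2 * \<alpha>)"
  \<comment> \<open>The largest coefficient in the upper bound, that of \<open>S\<close>: 2 from the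
    doubled mixed part and \<open>4 * N\<close> from the discrete part.\<close>
  define C where "C = 2 + 4 * real N"
  have c: "0 < c" "c \<le> 1"
    using assms powr_mono[of "- (1 + 2 * \<alpha>)" 0 "real (N + 1)"] by (auto simp: c_def)
  have "ennreal c * (gagliardo_sq \<alpha> u + L2_sq (\<lambda>x. u x - unit_mean u)
          + (\<Sum>k=2..N+1. ennreal (\<bar>u (real k) - unit_mean u\<bar>\<^sup>2))) \<le> hybrid_energy N \<alpha> u
      \<and> hybrid_energy N \<alpha> u \<le> ennreal C * (gagliardo_sq \<alpha> u + L2_sq (\<lambda>x. u x - unit_mean u)
          + (\<Sum>k=2..N+1. ennreal (\<bar>u (real k) - unit_mean u\<bar>\<^sup>2)))"
    if "u \<in> hybrid_space N \<alpha>" for u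
  proof -
    have L2: "u \<in> L2_space"
      using that by (simp add: hybrid_space_def H_space_def)
    then have u: "set_borel_measurable borel {0..1} u"
      by (simp add: L2_space_def)
    define G where "G = gagliardo_sq \<alpha> u"
    define L where "L = L2_sq (\<lambda>x. u x - unit_mean u)"
    define S where "S = (\<Sum>k=2..N+1. \<bar>u (real k) - unit_mean u\<bar>\<^sup>2)"
    define X where "X = (\<Sum>k=2..N+1. \<integral>\<^sup>+x\<in>{0..1}. ennreal (gagliardo_quotient \<alpha> u x (real k)) \<partial>lborel)"
    define Y where "Y = (\<Sum>j=2..N+1. \<Sum>k=2..N+1. gagliardo_quotient \<alpha> u (real j) (real k))"
    have S: "(\<Sum>k=2..N+1. ennreal (\<bar>u (real k) - unit_mean u\<bar>\<^sup>2)) = ennreal S" and S0: "0 \<le> S"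
      unfolding S_def by (rule sum_ennreal, simp, intro sum_nonneg, simp)
    have q0: "0 \<le> gagliardo_quotient \<alpha> u x y" for x y
      by (simp add: gagliardo_quotient_def)
    have E: "hybrid_energy N \<alpha> u = G + 2 * X + ennreal Y"
      unfolding hybrid_energy_split[OF u] G_def X_def Y_def
      by (simp only: sum_ennreal q0 sum_nonneg)
    \<comment> \<open>The variance identity is summed over the \<open>N\<close> isolated points, so
      the variance \<open>L\<close> is counted \<open>N\<close> times.\<close>
    have sumL2: "(\<Sum>k=2..N+1. L2_sq (\<lambda>x. u x - u (real k))) = of_nat N * L + ennreal S"
      by (subst L2_sq_diff_const[OF L2])
         (simp only: sum.distrib S sum_constant card_atLeastAtMost, simp add: L_def)
    have "ennreal c * (\<Sum>k=2..N+1. L2_sq (\<lambda>x. u x - u (real k))) \<le> X"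
      unfolding X_def c_def sum_distrib_left using assms u
      by (intro sum_mono set_nn_integral_gagliardo_quotient_ge) auto
    then have lo: "ennreal c * (of_nat N * L + ennreal S) \<le> X"
      unfolding sumL2 .
    have "X \<le> (\<Sum>k=2..N+1. L2_sq (\<lambda>x. u x - u (real k)))"
      unfolding X_def using assms
      by (intro sum_mono set_nn_integral_gagliardo_quotient_le) auto
    then have up: "X \<le> of_nat N * L + ennreal S"
      unfolding sumL2 .
    \<comment> \<open>The Gagliardo term enters the energy with coefficient 1, hence the need for
      \<open>c \<le> 1\<close>.\<close>
    have "ennreal c * G \<le> 1 * G"
      using c by (intro mult_right_mono) (auto simp: ennreal_le_1)
    \<comment> \<open>At least one isolated point exists, so the mixed part controls a full copy of
      \<open>L\<close>.\<close>
    moreover have "1 * L \<le> of_nat N * L"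
    proof (rule mult_right_mono)
      show "1 \<le> (of_nat N :: ennreal)"
        using of_nat_mono[of 1 N, where ?'a=ennreal] assms(1) by simp
    qed simp
    then have "ennreal c * (L + ennreal S) \<le> X"
      by (intro order.trans[OF _ lo] mult_left_mono add_right_mono) auto
    ultimately have "ennreal c * (G + L + ennreal S) \<le> G + X"
      unfolding add.assoc distrib_left[of _ G] by (intro add_mono) simp_all
    \<comment> \<open>The second copy of \<open>X\<close> and the discrete part are nonnegative and
      are discarded.\<close>
    also have "\<dots> \<le> hybrid_energy N \<alpha> u"
      unfolding E mult_2 by (simp add: add_increasing2 add.assoc)
    finally have lower: "ennreal c * (G + L + ennreal S) \<le> hybrid_energy N \<alpha> u" .
    have "ennreal Y \<le> ennreal (4 * real N * S)"
      unfolding Y_def S_def by (intro ennreal_leI sum_gagliardo_quotient_le assms)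
    also have "\<dots> = of_nat (4 * N) * ennreal S"
      using S0 by (simp add: ennreal_mult ennreal_of_nat_eq_real_of_nat)
    finally have Y: "ennreal Y \<le> of_nat (4 * N) * ennreal S" .
    have C: "ennreal C = of_nat (2 + 4 * N)"
      by (simp add: C_def ennreal_of_nat_eq_real_of_nat)
    have "hybrid_energy N \<alpha> u
        \<le> G + 2 * (of_nat N * L + ennreal S) + of_nat (4 * N) * ennreal S"
      unfolding E using up Y by (intro add_mono mult_left_mono) auto
    \<comment> \<open>All coefficients are written as naturals, so that the next step only compares
      1, \<open>2 * N\<close> and \<open>2 + 4 * N\<close> with \<open>2 + 4 * N\<close>.\<close>
    also have "\<dots> = of_nat 1 * G + of_nat (2 * N) * L + of_nat (2 + 4 * N) * ennreal S"
      by (simp add: distrib_left distrib_right mult.assoc add.assoc mult_2)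
    also have "\<dots> \<le> ennreal C * G + ennreal C * L + ennreal C * ennreal S"
      unfolding C by (intro add_mono mult_right_mono of_nat_mono) auto
    finally have upper: "hybrid_energy N \<alpha> u \<le> ennreal C * (G + L + ennreal S)"
      by (simp only: distrib_left)
    show ?thesis
      using lower upper unfolding S G_def L_def by blast
  qed
  moreover have "C > 0" by (simp add: C_def)
  ultimately show ?thesis
    using c unfolding Let_def by blast
qed

end
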